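(* Let $p$ be an odd prime, let $r$ be an integer relatively prime to $p$, and let $\varphi$ be the endomorphism of the dihedral quandle $R_{p^2}$ given by $\varphi(x)=px$. Then the quiver invariant $\mathcal{Q}^{\varphi}_{R_{p^2}}$ distinguishes $T(2,p)\# T(2,p)$ from the pretzel link $P(p^2,2r,p^2)$; that is, the quivers $\mathcal{Q}^{\varphi}_{R_{p^2}}(T(2,p)\# T(2,p))$ and $\mathcal{Q}^{\varphi}_{R_{p^2}}(P(p^2,2r,p^2))$ are not isomorphic as directed graphs.
   Context: The dihedral quandle $R_n$ is the set $\mathbb{Z}/n\mathbb{Z}$ with $x\triangleright y=2y-x \pmod n$. For a link $L$ with diagram $D$, an $R_n$-coloring is a labeling of the arcs of $D$ (from undercrossing to undercrossing) by elements of $\mathbb{Z}/n\mathbb{Z}$ such that at each crossing with overarc labeled $y$ and underarcs labeled $x,z$ one has $z=2y-x$. The colorings are identified with the set $\mathrm{Hom}(X_L,R_n)$ of homomorphisms from the fundamental quandle $X_L$ of $L$ to $R_n$. For an endomorphism $\varphi$ of $R_n$, the quandle coloring quiver $\mathcal{Q}^{\varphi}_{R_n}(L)$ is the directed graph with vertex set $\mathrm{Hom}(X_L,R_n)$ and one edge from each vertex $v$ to $\varphi\circ v$. $T(2,p)$ is the $(2,p)$ torus knot, $\#$ is connected sum, and $P(a,b,c)$ is the pretzel link whose standard diagram has three vertical twist columns with $a$, $b$, $c$ crossings (signed), adjacent columns being joined cyclically at top and bottom. *)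

theory Defs
  imports
    "HOL-Computational_Algebra.Primes"
    "HOL-Library.FuncSet"
    "Graph_Theory.Digraph_Isomorphism"
begin

section \<open>Link diagrams\<close>

text \<open>
  Links are given by planar diagram (PD) codes. The plane curve is cut into edges; a code lists how
  the ends of the edges meet, and every edge label occurs exactly twice in it.

  In \<open>Crossing a b c d\<close> the four edge ends are listed counterclockwise, starting with an end of the
  under-strand: the under-strand passes through \<open>a\<close>, \<open>c\<close> and the over-strand through \<open>b\<close>, \<open>d\<close>.
  No orientation is recorded, and \<open>Crossing a b c d\<close> and \<open>Crossing c d a b\<close> describe the same crossing.
  \<open>Join a b\<close> is a bivalent point of the curve, at which the edges \<open>a\<close> and \<open>b\<close> are glued.
\<close>

datatype 'e node = Crossing 'e 'e 'e 'e | Join 'e 'e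

type_synonym 'e diagram = "'e node list"

definition edges :: "'e diagram \<Rightarrow> 'e set" where
  "edges D = (\<Union>v \<in> set D. set_node v)"

text \<open>
  Two edges lie on the same arc (running from undercrossing to undercrossing) iff they are linked by
  passing over crossings and through bivalent points.
\<close>

definition continues :: "'e diagram \<Rightarrow> 'e rel" where
  "continues D = {(b, d). \<exists>a c. Crossing a b c d \<in> set D} \<union> {(a, b). Join a b \<in> set D}"

definition arc_of :: "'e diagram \<Rightarrow> 'e \<Rightarrow> 'e set" where
  "arc_of D e = (continues D \<union> (continues D)\<inverse>)\<^sup>* `` {e}"

definition link_arcs :: "'e diagram \<Rightarrow> 'e set set" where
  "link_arcs D = arc_of D ` edges D"


section \<open>Dihedral quandles, colorings, and the coloring quiver\<close>

definition dihedral_carrier :: "nat \<Rightarrow> int set" where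
  "dihedral_carrier n = {0..<int n}"

definition dihedral_op :: "nat \<Rightarrow> int \<Rightarrow> int \<Rightarrow> int" where
  "dihedral_op n x y = (2 * y - x) mod int n"

definition dihedral_endos :: "nat \<Rightarrow> (int \<Rightarrow> int) set" where
  "dihedral_endos n = {\<phi> \<in> dihedral_carrier n \<rightarrow> dihedral_carrier n.
     \<forall>x \<in> dihedral_carrier n. \<forall>y \<in> dihedral_carrier n.
       \<phi> (dihedral_op n x y) = dihedral_op n (\<phi> x) (\<phi> y)}"

text \<open>
  The two underarcs \<open>x\<close>, \<open>z\<close> at a crossing may be exchanged in the condition \<open>z = 2y - x\<close>, so that no
  orientation is needed. Colorings are extensional functions on the arcs, hence equal iff they label
  all arcs equally; they represent the quandle homomorphisms from the fundamental quandle.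
\<close>

definition colorings :: "nat \<Rightarrow> 'e diagram \<Rightarrow> ('e set \<Rightarrow> int) set" where
  "colorings n D = {f \<in> link_arcs D \<rightarrow>\<^sub>E dihedral_carrier n.
     \<forall>a b c d. Crossing a b c d \<in> set D \<longrightarrow>
       f (arc_of D c) = dihedral_op n (f (arc_of D a)) (f (arc_of D b))}"

text \<open>The vertex \<open>v\<close> also serves as the name of the unique edge that leaves it.\<close>

definition coloring_quiver ::
  "nat \<Rightarrow> (int \<Rightarrow> int) \<Rightarrow> 'e diagram \<Rightarrow> ('e set \<Rightarrow> int, 'e set \<Rightarrow> int) pre_digraph" where
  "coloring_quiver n \<phi> D =
     \<lparr>verts = colorings n D, arcs = colorings n D,
      tail = (\<lambda>v. v), head = (\<lambda>v. compose (link_arcs D) \<phi> v)\<rparr>"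

lemma arc_of_in_link_arcs:
  assumes "v \<in> set D" "e \<in> set_node v"
  shows "arc_of D e \<in> link_arcs D"
  using assms by (auto simp: link_arcs_def edges_def)

lemma wf_coloring_quiver:
  assumes "\<phi> \<in> dihedral_endos n"
  shows "wf_digraph (coloring_quiver n \<phi> D)"
proof
  fix v assume "v \<in> arcs (coloring_quiver n \<phi> D)"
  then have v: "v \<in> colorings n D" by (simp add: coloring_quiver_def)
  then show "tail (coloring_quiver n \<phi> D) v \<in> verts (coloring_quiver n \<phi> D)"
    by (simp add: coloring_quiver_def)
  have "compose (link_arcs D) \<phi> v (arc_of D c) =
      dihedral_op n (compose (link_arcs D) \<phi> v (arc_of D a)) (compose (link_arcs D) \<phi> v (arc_of D b))"
    if "Crossing a b c d \<in> set D" for a b c d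
  proof -
    have arcs: "arc_of D a \<in> link_arcs D" "arc_of D b \<in> link_arcs D" "arc_of D c \<in> link_arcs D"
      using arc_of_in_link_arcs[OF that] by auto
    then have "v (arc_of D a) \<in> dihedral_carrier n" "v (arc_of D b) \<in> dihedral_carrier n"
      using v by (auto simp: colorings_def)
    moreover have "v (arc_of D c) = dihedral_op n (v (arc_of D a)) (v (arc_of D b))"
      using v that unfolding colorings_def by blast
    ultimately show ?thesis
      using assms arcs by (simp add: compose_eq dihedral_endos_def)
  qed
  moreover have "compose (link_arcs D) \<phi> v \<in> link_arcs D \<rightarrow>\<^sub>E dihedral_carrier n"
    using v assms by (auto simp: colorings_def dihedral_endos_def compose_def)
  ultimately show "head (coloring_quiver n \<phi> D) v \<in> verts (coloring_quiver n \<phi> D)"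
    by (auto simp: coloring_quiver_def colorings_def)
qed

lemma mult_in_dihedral_endos:
  assumes "n > 0"
  shows "(\<lambda>x. (k * x) mod int n) \<in> dihedral_endos n"
proof -
  have "(k * ((2 * y - x) mod int n)) mod int n
      = (2 * ((k * y) mod int n) - (k * x) mod int n) mod int n" for x y :: int
  proof -
    have "(k * ((2 * y - x) mod int n)) mod int n = (2 * (k * y) - k * x) mod int n"
      by (simp add: mod_simps algebra_simps)
    also have "\<dots> = (2 * ((k * y) mod int n) - (k * x) mod int n) mod int n"
      by (intro mod_diff_cong) (simp_all add: mod_simps)
    finally show ?thesis .
  qed
  then show ?thesis
    using assms by (auto simp: dihedral_endos_def dihedral_carrier_def dihedral_op_def)
qed


section \<open>Torus links, connected sums, pretzel links\<close>

text \<open>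
  A vertical column of \<open>\<bar>k\<bar>\<close> half twists of two strands. The edges \<open>Lft j\<close> and \<open>Rgt j\<close> are the left and
  the right strand at level \<open>j\<close>, level \<open>0\<close> being the top and level \<open>\<bar>k\<bar>\<close> the bottom; they are the upper
  ends of the crossing number \<open>j\<close> and the lower ends of the crossing number \<open>j - 1\<close>. The twists are
  right-handed (the strand from bottom left to top right passes over) for \<open>k > 0\<close> and left-handed
  for \<open>k < 0\<close>. The opposite convention would replace a diagram by its mirror image in a line of the
  plane.
\<close>

datatype strand = Lft nat | Rgt nat

definition twist_column :: "int \<Rightarrow> strand diagram" where
  "twist_column k = map (\<lambda>j.
     if k > 0 then Crossing (Lft j) (Lft (Suc j)) (Rgt (Suc j)) (Rgt j)
     else Crossing (Rgt j) (Lft j) (Lft (Suc j)) (Rgt (Suc j))) [0..<nat \<bar>k\<bar>]"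

text \<open>The \<open>(2, k)\<close> torus link, as the closure of the 2-strand braid with \<open>k\<close> crossings.\<close>

definition torus_2 :: "int \<Rightarrow> strand diagram" where
  "torus_2 k = [Join (Lft (nat \<bar>k\<bar>)) (Lft 0), Join (Rgt (nat \<bar>k\<bar>)) (Rgt 0)] @ twist_column k"

text \<open>
  The connected sum of \<open>D\<close> and \<open>E\<close>, formed at the bivalent points \<open>Join a b\<close> of \<open>D\<close> and \<open>Join c d\<close> of \<open>E\<close>.
  Both curves are cut there, and the ends are reconnected such that the directions from \<open>a\<close> to \<open>b\<close> and
  from \<open>c\<close> to \<open>d\<close> fit together.
\<close>

definition connected_sum ::
  "'e diagram \<Rightarrow> 'e \<times> 'e \<Rightarrow> 'f diagram \<Rightarrow> 'f \<times> 'f \<Rightarrow> ('e + 'f) diagram" where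
  "connected_sum D = (\<lambda>(a, b) E (c, d).
     [Join (Inl a) (Inr d), Join (Inr c) (Inl b)]
     @ map (map_node Inl) (remove1 (Join a b) D)
     @ map (map_node Inr) (remove1 (Join c d) E))"

text \<open>
  \<open>T(2,k) # T(2,k)\<close> for odd \<open>k\<close>. For a knot the result does not depend on the chosen points.
\<close>

definition torus_2_sum :: "int \<Rightarrow> (strand + strand) diagram" where
  "torus_2_sum k =
     (let e = (Lft (nat \<bar>k\<bar>), Lft 0) in connected_sum (torus_2 k) e (torus_2 k) e)"

text \<open>
  The edges of the pretzel link are tagged with the number \<open>0\<close>, \<open>1\<close>, \<open>2\<close> of their column. The right
  strand of every column is joined, at top and bottom, to the left strand of the cyclically next one.
\<close>

definition pretzel :: "int \<Rightarrow> int \<Rightarrow> int \<Rightarrow> (nat \<times> strand) diagram" where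
  "pretzel a b c =
     (let col = (\<lambda>i k. map (map_node (Pair i)) (twist_column k));
          join = (\<lambda>i k j l. [Join (i, Rgt 0) (j, Lft 0),
                             Join (i, Rgt (nat \<bar>k\<bar>)) (j, Lft (nat \<bar>l\<bar>))])
      in col 0 a @ col 1 b @ col 2 c @ join 0 a 1 b @ join 1 b 2 c @ join 2 c 0 a)"

end

theory Submission
  imports Defs "HOL-Number_Theory.Cong"
begin

text \<open>
  The invariant that separates the quivers is the number of vertices with an incoming edge, that is,
  the number of colorings of the form \<open>\<phi> \<circ> v\<close>; the total numbers of vertices agree.

  Along a column of half twists the labels form an arithmetic progression, since each crossing
  imposes \<open>z = 2y - x\<close>. Let \<open>d\<close> be its difference. In a summand \<open>T(2,p)\<close> the progression has to close
  up after \<open>p\<close> steps, so \<open>p d = 0\<close> modulo \<open>p\<^sup>2\<close>. Multiplication by \<open>p\<close> therefore kills both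
  differences: \<open>\<phi> \<circ> v\<close> is constant, its value is a multiple of \<open>p\<close>, and at most \<open>p\<close> vertices have an
  incoming edge (\<open>card_heads_torus_2_sum\<close>).

  In the pretzel link the outer columns have \<open>p\<^sup>2\<close> crossings, so a progression with any difference
  closes up modulo \<open>p\<^sup>2\<close>. One can thus let the first column carry any difference \<open>d\<close>, the third
  \<open>-d\<close>, and keep the middle column constant. The first two labels \<open>x\<close>, \<open>y\<close> of such a coloring are
  arbitrary, and after multiplication by \<open>p\<close> the pair still takes \<open>p\<^sup>2\<close> values; so at least
  \<open>p\<^sup>2 > p\<close> vertices have an incoming edge (\<open>card_heads_pretzel\<close>).
\<close>

section \<open>Vertices with an incoming edge\<close>

lemma card_heads_digraph_iso:
  assumes "digraph_iso G H"
  shows "card (head H ` arcs H) = card (head G ` arcs G)"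
proof -
  from assms obtain hom where hom: "pre_digraph.digraph_isomorphism G hom"
    and H: "H = app_iso hom G"
    by (auto simp: digraph_iso_def)
  interpret wf_digraph G
    using hom by (simp add: pre_digraph.digraph_isomorphism_def)
  have "head H ` arcs H = iso_verts hom ` head G ` arcs G"
    using hom by (auto simp: H image_image digraph_isomorphism_def app_iso_def intro!: image_cong)
  moreover have "inj_on (iso_verts hom) (head G ` arcs G)"
    using hom by (auto simp: digraph_isomorphism_def intro: inj_on_subset)
  ultimately show ?thesis
    by (simp add: card_image)
qed

lemma finite_colorings: "finite (colorings n D)"
proof (rule finite_subset)
  have "finite (set_node v)" for v :: "'e node"
    by (cases v) auto
  then have "finite (link_arcs D)" for D :: "'e diagram"
    by (simp add: link_arcs_def edges_def)
  then show "finite (link_arcs D \<rightarrow>\<^sub>E dihedral_carrier n)"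
    by (intro finite_PiE) (simp_all add: dihedral_carrier_def)
qed (auto simp: colorings_def)


section \<open>Colorings as labelings of edges\<close>

text \<open>
  Arcs are equivalence classes of edges, which are awkward to compute. Labelings of the edges
  that are constant along arcs carry the same information and can be checked crossing by crossing.
\<close>

definition edge_colorings :: "nat \<Rightarrow> 'e diagram \<Rightarrow> ('e \<Rightarrow> int) set" where
  "edge_colorings n D = {g \<in> edges D \<rightarrow> dihedral_carrier n.
     (\<forall>a b c d. Crossing a b c d \<in> set D \<longrightarrow> g d = g b \<and> g c = dihedral_op n (g a) (g b)) \<and>
     (\<forall>a b. Join a b \<in> set D \<longrightarrow> g a = g b)}"

lemma arc_of_eqI:
  assumes "(a, b) \<in> continues D"
  shows "arc_of D a = arc_of D b"
proof -
  let ?R = "(continues D \<union> (continues D)\<inverse>)\<^sup>*"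
  have "(a, b) \<in> ?R" "(b, a) \<in> ?R"
    using assms by auto
  then show ?thesis
    by (auto simp: arc_of_def intro: rtrancl_trans)
qed

lemma edge_colorings_of_coloring:
  assumes "v \<in> colorings n D"
  shows "(\<lambda>e. v (arc_of D e)) \<in> edge_colorings n D"
proof -
  have "arc_of D b = arc_of D d" if "Crossing a b c d \<in> set D" for a b c d
    using that by (intro arc_of_eqI) (auto simp: continues_def)
  moreover have "arc_of D a = arc_of D b" if "Join a b \<in> set D" for a b
    using that by (intro arc_of_eqI) (auto simp: continues_def)
  moreover have "v (arc_of D e) \<in> dihedral_carrier n" if "e \<in> edges D" for e
    using assms that by (auto simp: colorings_def link_arcs_def)
  ultimately show ?thesis
    using assms unfolding edge_colorings_def colorings_def by fastforce
qed

lemma edge_coloring_constant_on_arc: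
  assumes "g \<in> edge_colorings n D" and "e' \<in> arc_of D e"
  shows "g e' = g e"
proof -
  have step: "g a = g b" if "(a, b) \<in> continues D" for a b
    using assms(1) that by (fastforce simp: edge_colorings_def continues_def)
  have "(e, e') \<in> (continues D \<union> (continues D)\<inverse>)\<^sup>*"
    using assms(2) by (simp add: arc_of_def)
  then show ?thesis
    by induction (auto dest: step)
qed

lemma coloring_of_edge_coloring:
  assumes g: "g \<in> edge_colorings n D"
  obtains v where "v \<in> colorings n D" and "\<And>e. e \<in> edges D \<Longrightarrow> v (arc_of D e) = g e"
proof
  define v where "v = (\<lambda>A\<in>link_arcs D. g (SOME e. e \<in> A))"
  show v: "v (arc_of D e) = g e" if "e \<in> edges D" for e
  proof -
    have "e \<in> arc_of D e"
      by (simp add: arc_of_def)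
    then have "(SOME e'. e' \<in> arc_of D e) \<in> arc_of D e"
      by (rule someI)
    with that show ?thesis
      by (auto simp: v_def link_arcs_def intro: edge_coloring_constant_on_arc[OF g])
  qed
  have "v \<in> link_arcs D \<rightarrow>\<^sub>E dihedral_carrier n"
  proof (rule PiE_I)
    fix A assume "A \<in> link_arcs D"
    then show "v A \<in> dihedral_carrier n"
      using g by (auto simp: link_arcs_def v edge_colorings_def)
  qed (simp add: v_def)
  moreover have "v (arc_of D c) = dihedral_op n (v (arc_of D a)) (v (arc_of D b))"
    if "Crossing a b c d \<in> set D" for a b c d
  proof -
    have "a \<in> edges D" "b \<in> edges D" "c \<in> edges D"
      using that by (force simp: edges_def)+
    then show ?thesis
      using g that by (auto simp: v edge_colorings_def)
  qed
  ultimately show "v \<in> colorings n D"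
    by (auto simp: colorings_def)
qed


section \<open>The connected sum of torus knots\<close>

text \<open>
  Each crossing continues the right strand as the next left strand and imposes
  \<open>r (j + 1) - l (j + 1) = r j - l j\<close>. The map \<open>\<tau>\<close> places the column into a larger diagram.
\<close>

lemma twist_column_progression:
  assumes g: "g \<in> edge_colorings n D"
    and column: "map_node \<tau> ` set (twist_column (int m)) \<subseteq> set D"
    and "j \<le> m"
  defines "x \<equiv> g (\<tau> (Lft 0))" and "d \<equiv> g (\<tau> (Rgt 0)) - g (\<tau> (Lft 0))"
  shows "[g (\<tau> (Lft j)) = x + int j * d] (mod int n)
    \<and> [g (\<tau> (Rgt j)) = x + (int j + 1) * d] (mod int n)"
  using \<open>j \<le> m\<close>
proof (induction j)
  case 0
  then show ?case
    by (simp add: x_def d_def)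
next
  case (Suc j)
  let ?l = "\<lambda>j. g (\<tau> (Lft j))" and ?r = "\<lambda>j. g (\<tau> (Rgt j))"
  have "Crossing (Lft j) (Lft (Suc j)) (Rgt (Suc j)) (Rgt j) \<in> set (twist_column (int m))"
    using Suc.prems by (auto simp: twist_column_def)
  then have "Crossing (\<tau> (Lft j)) (\<tau> (Lft (Suc j))) (\<tau> (Rgt (Suc j))) (\<tau> (Rgt j)) \<in> set D"
    using column by force
  then have l: "?l (Suc j) = ?r j" and r: "?r (Suc j) = (2 * ?r j - ?l j) mod int n"
    using g by (force simp: edge_colorings_def dihedral_op_def)+
  have IH: "[?l j = x + int j * d] (mod int n)" "[?r j = x + (int j + 1) * d] (mod int n)"
    using Suc by auto
  then have "[2 * ?r j - ?l j = 2 * (x + (int j + 1) * d) - (x + int j * d)] (mod int n)"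
    by (intro cong_diff cong_mult) auto
  also have "2 * (x + (int j + 1) * d) - (x + int j * d) = x + (int (Suc j) + 1) * d"
    by (simp add: algebra_simps)
  finally have "[?r (Suc j) = x + (int (Suc j) + 1) * d] (mod int n)"
    by (simp add: r cong_def)
  moreover have "[?l (Suc j) = x + int (Suc j) * d] (mod int n)"
    using IH(2) by (simp add: l add.commute)
  ultimately show ?case
    by blast
qed

text \<open>
  A closed progression of length \<open>p\<close> has a difference \<open>d\<close> with \<open>p d = 0\<close> modulo \<open>p\<^sup>2\<close>, so
  multiplication by \<open>p\<close> identifies all labels.
\<close>

lemma torus_column_collapse:
  assumes g: "g \<in> edge_colorings (p\<^sup>2) D"
    and column: "map_node \<tau> ` set (twist_column (int p)) \<subseteq> set D"
    and closed: "Join (\<tau> (Rgt p)) (\<tau> (Rgt 0)) \<in> set D"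
    and "j \<le> p"
  shows "[int p * g (\<tau> (Lft j)) = int p * g (\<tau> (Lft 0))] (mod int (p\<^sup>2))"
    and "[int p * g (\<tau> (Rgt j)) = int p * g (\<tau> (Lft 0))] (mod int (p\<^sup>2))"
proof -
  define x where "x = g (\<tau> (Lft 0))"
  define d where "d = g (\<tau> (Rgt 0)) - x"
  note prog = twist_column_progression[OF g column, folded x_def, folded d_def]
  have "g (\<tau> (Rgt p)) = x + d"
    using g closed by (force simp: edge_colorings_def d_def)
  then have "[x + d = x + (int p + 1) * d] (mod int (p\<^sup>2))"
    using prog[of p] by simp
  then have "int (p\<^sup>2) dvd int p * d"
    by (simp add: cong_iff_dvd_diff algebra_simps)
  then have drop: "[int p * (x + i * d) = int p * x] (mod int (p\<^sup>2))" for i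
    by (simp add: cong_iff_dvd_diff algebra_simps)
       (metis dvd_mult mult.left_commute)
  show "[int p * g (\<tau> (Lft j)) = int p * g (\<tau> (Lft 0))] (mod int (p\<^sup>2))"
    using prog[OF \<open>j \<le> p\<close>] drop cong_trans cong_scalar_left unfolding x_def[symmetric] by metis
  show "[int p * g (\<tau> (Rgt j)) = int p * g (\<tau> (Lft 0))] (mod int (p\<^sup>2))"
    using prog[OF \<open>j \<le> p\<close>] drop cong_trans cong_scalar_left unfolding x_def[symmetric] by metis
qed

lemma set_torus_2_sum:
  "set (torus_2_sum (int p)) =
     {Join (Inl (Lft p)) (Inr (Lft 0)), Join (Inr (Lft p)) (Inl (Lft 0)),
      Join (Inl (Rgt p)) (Inl (Rgt 0)), Join (Inr (Rgt p)) (Inr (Rgt 0))}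
     \<union> map_node Inl ` set (twist_column (int p)) \<union> map_node Inr ` set (twist_column (int p))"
  by (auto simp: torus_2_sum_def connected_sum_def torus_2_def Let_def)

lemma edges_torus_2_sum:
  assumes "e \<in> edges (torus_2_sum (int p))"
  obtains j where "j \<le> p" and "e \<in> {Inl (Lft j), Inl (Rgt j), Inr (Lft j), Inr (Rgt j)}"
  using assms by (fastforce simp: edges_def set_torus_2_sum twist_column_def split: if_splits)

lemma card_heads_torus_2_sum:
  assumes \<phi>: "\<And>x. x \<in> dihedral_carrier (p\<^sup>2) \<Longrightarrow> \<phi> x = (int p * x) mod int (p\<^sup>2)" and "p > 0"
  defines "Q \<equiv> coloring_quiver (p\<^sup>2) \<phi> (torus_2_sum (int p))"
  shows "card (head Q ` arcs Q) \<le> p"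
proof -
  let ?D = "torus_2_sum (int p)"
  let ?const = "\<lambda>t. \<lambda>A\<in>link_arcs ?D. int p * t"
  have "head Q v \<in> ?const ` {0..<int p}" if "v \<in> arcs Q" for v
  proof -
    define g where "g = (\<lambda>e. v (arc_of ?D e))"
    have g: "g \<in> edge_colorings (p\<^sup>2) ?D"
      using that unfolding Q_def g_def by (simp add: coloring_quiver_def edge_colorings_of_coloring)
    let ?x = "g (Inl (Lft 0))"
    have L: "[int p * g (Inl (Lft j)) = int p * ?x] (mod int (p\<^sup>2))"
      "[int p * g (Inl (Rgt j)) = int p * ?x] (mod int (p\<^sup>2))" if "j \<le> p" for j
      using torus_column_collapse[OF g _ _ that, where \<tau> = Inl] by (auto simp: set_torus_2_sum)
    have R: "[int p * g (Inr (Lft j)) = int p * g (Inr (Lft 0))] (mod int (p\<^sup>2))"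
      "[int p * g (Inr (Rgt j)) = int p * g (Inr (Lft 0))] (mod int (p\<^sup>2))" if "j \<le> p" for j
      using torus_column_collapse[OF g _ _ that, where \<tau> = Inr] by (auto simp: set_torus_2_sum)
    have "g (Inl (Lft p)) = g (Inr (Lft 0))"
      using g by (auto simp: edge_colorings_def set_torus_2_sum)
    then have glue: "[int p * g (Inr (Lft 0)) = int p * ?x] (mod int (p\<^sup>2))"
      using L(1)[of p] by simp
    have same: "[int p * g e = int p * ?x] (mod int (p\<^sup>2))" if "e \<in> edges ?D" for e
    proof -
      from that obtain j where "j \<le> p" "e \<in> {Inl (Lft j), Inl (Rgt j), Inr (Lft j), Inr (Rgt j)}"
        by (rule edges_torus_2_sum)
      with L R glue show ?thesis
        by (blast intro: cong_trans)
    qed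
    have "head Q v = ?const (?x mod int p)"
    proof
      fix A
      show "head Q v A = ?const (?x mod int p) A"
      proof (cases "A \<in> link_arcs ?D")
        case True
        then obtain e where e: "e \<in> edges ?D" "A = arc_of ?D e"
          by (auto simp: link_arcs_def)
        then have "head Q v A = \<phi> (g e)"
          using True by (simp add: Q_def coloring_quiver_def compose_eq g_def)
        also have "\<dots> = (int p * g e) mod int (p\<^sup>2)"
          using g e by (intro \<phi>) (auto simp: edge_colorings_def)
        also have "\<dots> = (int p * ?x) mod int (p\<^sup>2)"
          using same[OF e(1)] by (simp add: cong_def)
        also have "\<dots> = int p * (?x mod int p)"
          by (simp add: power2_eq_square)
        finally show ?thesis
          using True by simp
      qed (simp add: Q_def coloring_quiver_def compose_def)
    qed
    then show ?thesis
      using \<open>p > 0\<close> by auto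
  qed
  then have "head Q ` arcs Q \<subseteq> ?const ` {0..<int p}"
    by blast
  then have "card (head Q ` arcs Q) \<le> card {0..<int p}"
    by (rule surj_card_le[rotated]) simp
  then show ?thesis
    by simp
qed


section \<open>The pretzel link\<close>

lemma set_pretzel:
  "set (pretzel a b c) =
     map_node (Pair 0) ` set (twist_column a) \<union> map_node (Pair 1) ` set (twist_column b) \<union>
     map_node (Pair 2) ` set (twist_column c) \<union>
     {Join (0, Rgt 0) (1, Lft 0), Join (0, Rgt (nat \<bar>a\<bar>)) (1, Lft (nat \<bar>b\<bar>)),
      Join (1, Rgt 0) (2, Lft 0), Join (1, Rgt (nat \<bar>b\<bar>)) (2, Lft (nat \<bar>c\<bar>)),
      Join (2, Rgt 0) (0, Lft 0), Join (2, Rgt (nat \<bar>c\<bar>)) (0, Lft (nat \<bar>a\<bar>))}"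
  by (auto simp: pretzel_def Let_def)

text \<open>
  Integer representatives of labels whose progressions have the differences \<open>y - x\<close>, \<open>0\<close>, \<open>x - y\<close> in
  the three columns; they sum to zero, which makes the joins at the top compatible.
\<close>

fun pretzel_label :: "int \<Rightarrow> int \<Rightarrow> nat \<times> strand \<Rightarrow> int" where
  "pretzel_label x y (i, Lft j) =
     (if i = 0 then x + int j * (y - x) else if i = 1 then y else y - int j * (y - x))"
| "pretzel_label x y (i, Rgt j) =
     (if i = 0 then y + int j * (y - x) else if i = 1 then y else x - int j * (y - x))"

text \<open>
  The labels at the bottom of an outer column differ from those at the top by \<open>\<plusminus>n (y - x)\<close>, which
  vanishes modulo \<open>n\<close>; this is what makes the joins at the bottom compatible.
\<close>

lemma pretzel_edge_coloring:
  assumes "n > 0"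
  shows "(\<lambda>e. pretzel_label x y e mod int n) \<in> edge_colorings n (pretzel (int n) k (int n))"
proof -
  let ?g = "\<lambda>e. pretzel_label x y e mod int n" and ?D = "pretzel (int n) k (int n)"
  have "?g d = ?g b \<and> ?g c = dihedral_op n (?g a) (?g b)" if "Crossing a b c d \<in> set ?D" for a b c d
  proof -
    have eq: "pretzel_label x y d = pretzel_label x y b \<and>
        pretzel_label x y c = 2 * pretzel_label x y b - pretzel_label x y a"
      using that by (auto simp: set_pretzel twist_column_def algebra_simps split: if_splits)
    have "?g c = dihedral_op n (?g a) (?g b)"
      unfolding eq[THEN conjunct2] dihedral_op_def by (intro mod_diff_cong) (simp_all add: mod_simps)
    with eq show ?thesis by simp
  qed
  moreover have "?g a = ?g b" if "Join a b \<in> set ?D" for a b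
    using that by (auto simp: set_pretzel twist_column_def mod_eq_dvd_iff split: if_splits)
  ultimately show ?thesis
    using assms by (auto simp: edge_colorings_def dihedral_carrier_def)
qed

lemma card_heads_pretzel:
  fixes k :: int
  assumes \<phi>: "\<And>x. x \<in> dihedral_carrier (p\<^sup>2) \<Longrightarrow> \<phi> x = (int p * x) mod int (p\<^sup>2)" and "p > 0"
  defines "Q \<equiv> coloring_quiver (p\<^sup>2) \<phi> (pretzel (int (p\<^sup>2)) k (int (p\<^sup>2)))"
  shows "p\<^sup>2 \<le> card (head Q ` arcs Q)"
proof -
  let ?D = "pretzel (int (p\<^sup>2)) k (int (p\<^sup>2))"
  let ?e = "(0, Lft 0) :: nat \<times> strand" and ?f = "(0, Rgt 0) :: nat \<times> strand"
  let ?values = "\<lambda>w. (w (arc_of ?D ?e), w (arc_of ?D ?f))"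
  let ?P = "(\<lambda>x. int p * x) ` {0..<int p}"
  have "Join ?f (1, Lft 0) \<in> set ?D" "Join (2, Rgt 0) ?e \<in> set ?D"
    by (auto simp: set_pretzel)
  then have ef: "?e \<in> edges ?D" "?f \<in> edges ?D"
    by (force simp: edges_def)+
  have "(int p * x, int p * y) \<in> ?values ` head Q ` arcs Q"
    if "x \<in> {0..<int p}" "y \<in> {0..<int p}" for x y
  proof -
    have "p\<^sup>2 > 0"
      using \<open>p > 0\<close> by simp
    then obtain v where v: "v \<in> colorings (p\<^sup>2) ?D"
      and label: "\<And>e. e \<in> edges ?D \<Longrightarrow> v (arc_of ?D e) = pretzel_label x y e mod int (p\<^sup>2)"
      using coloring_of_edge_coloring[OF pretzel_edge_coloring] by metis
    have head: "head Q v (arc_of ?D e) = int p * (pretzel_label x y e mod int p)"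
      if "e \<in> edges ?D" for e
    proof -
      have "arc_of ?D e \<in> link_arcs ?D"
        using that by (simp add: link_arcs_def)
      then have "head Q v (arc_of ?D e) = \<phi> (v (arc_of ?D e))"
        by (simp add: Q_def coloring_quiver_def compose_eq)
      also have "\<dots> = (int p * (pretzel_label x y e mod int (p\<^sup>2))) mod int (p\<^sup>2)"
        unfolding label[OF that] using \<open>p\<^sup>2 > 0\<close>
        by (intro \<phi>) (simp add: dihedral_carrier_def del: of_nat_power)
      also have "\<dots> = (int p * pretzel_label x y e) mod int (p\<^sup>2)"
        by (simp add: mod_simps)
      finally show ?thesis
        by (simp add: power2_eq_square)
    qed
    have "?values (head Q v) = (int p * x, int p * y)"
      unfolding head[OF ef(1)] head[OF ef(2)] using that by simp
    moreover have "v \<in> arcs Q"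
      using v by (simp add: Q_def coloring_quiver_def)
    ultimately show ?thesis
      by (metis (no_types, lifting) imageI)
  qed
  then have sub: "?P \<times> ?P \<subseteq> ?values ` head Q ` arcs Q"
    by blast
  have "card ?P = p"
    using \<open>p > 0\<close> by (subst card_image) (auto simp: inj_on_def)
  then have "p\<^sup>2 = card (?P \<times> ?P)"
    by (simp add: card_cartesian_product power2_eq_square)
  also have "\<dots> \<le> card (head Q ` arcs Q)"
    using sub by (rule surj_card_le[rotated]) (simp add: Q_def coloring_quiver_def finite_colorings)
  finally show ?thesis .
qed


section \<open>The quivers are not isomorphic\<close>

theorem theorem4p7:
  fixes p :: nat and r :: int and \<phi> :: "int \<Rightarrow> int"
  assumes "prime p" and "odd p" and "coprime r (int p)"
    and "\<phi> \<in> dihedral_endos (p\<^sup>2)"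
    and "\<And>x. x \<in> dihedral_carrier (p\<^sup>2) \<Longrightarrow> \<phi> x = (int p * x) mod int (p\<^sup>2)"
  shows "\<not> digraph_iso
    (coloring_quiver (p\<^sup>2) \<phi> (torus_2_sum (int p)))
    (coloring_quiver (p\<^sup>2) \<phi> (pretzel (int (p\<^sup>2)) (2 * r) (int (p\<^sup>2))))"
proof
  assume "digraph_iso
    (coloring_quiver (p\<^sup>2) \<phi> (torus_2_sum (int p)))
    (coloring_quiver (p\<^sup>2) \<phi> (pretzel (int (p\<^sup>2)) (2 * r) (int (p\<^sup>2))))"
  note card_eq = card_heads_digraph_iso[OF this]
  have "p > 1"
    using \<open>prime p\<close> by (rule prime_gt_1_nat)
  then have "p < p\<^sup>2"
    by (simp add: power2_eq_square)
  also have "p\<^sup>2 \<le> p"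
    using card_heads_pretzel[OF assms(5), of "2 * r"] card_heads_torus_2_sum[OF assms(5)] card_eq \<open>p > 1\<close> by simp
  finally show False
    by simp
qed

end
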